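(* Let $T$ be a tree and let $T'$ be the KC-transformation of $T$ with respect to a path of length $k$. Then the inequality $$\hom(H,T')\geq \hom(H,T)$$ holds in each of the following cases: (1) $k$ is even and $H$ is any tree; (2) $k$ is odd and $H$ is a starlike tree.
   Context: Graphs are finite, undirected, without loops and multiple edges. $\hom(H,G)$ denotes the number of homomorphisms from $H$ to $G$, i.e. maps $f:V(H)\to V(G)$ such that images of adjacent vertices are adjacent. A tree is starlike if it has at most one vertex of degree greater than two. The length of a path is its number of edges. KC-transformation: let $x$ and $y$ be two (distinct) vertices of a tree $T$ such that every interior vertex of the unique $x$–$y$ path $P$ in $T$ has degree two in $T$, and let $z$ be the neighbor of $y$ on this path. Let $N(y)$ be the set of neighbors of $y$. The KC-transformation $KC(T,x,y)$ of $T$ with respect to the path $P$ is the tree obtained from $T$ by deleting all edges between $y$ and $N(y)\setminus\{z\}$ and adding the edges between $x$ and $N(y)\setminus\{z\}$ instead. ($KC(T,x,y)$ and $KC(T,y,x)$ are isomorphic.) *)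

theory Defs
  imports "Graph_Theory.Graph_Theory" "HOL-Library.FuncSet"
begin

text \<open>
  A finite undirected simple graph is a \<^locale>\<open>pair_graph\<close>: a finite, loop-free, symmetric
  set of ordered pairs over a finite vertex set. An undirected edge between u and v is
  represented by the two arcs (u,v) and (v,u).
\<close>

definition neighbors :: "'a pair_pre_digraph \<Rightarrow> 'a \<Rightarrow> 'a set" where
  "neighbors G v = {w. (v, w) \<in> parcs G}"

definition degree :: "'a pair_pre_digraph \<Rightarrow> 'a \<Rightarrow> nat" where
  "degree G v = card (neighbors G v)"

text \<open>
  The predicate \<^const>\<open>Digraph_Component.tree\<close> forbids directed cycles and so is not usable here: in a
  symmetric digraph every edge u, v yields the directed cycle u, v, u of length 2. Cycles of an
  undirected graph are those of length at least 3. Connectedness includes that the vertex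
  set is nonempty.
\<close>

definition undirected_tree :: "'a pair_pre_digraph \<Rightarrow> bool" where
  "undirected_tree G \<longleftrightarrow> pair_graph G \<and> Digraph_Component.connected (with_proj G) \<and>
     \<not> (\<exists>c. pre_digraph.cycle (with_proj G) c \<and> 3 \<le> length c)"

definition starlike_tree :: "'a pair_pre_digraph \<Rightarrow> bool" where
  "starlike_tree G \<longleftrightarrow> undirected_tree G \<and> card {v \<in> pverts G. degree G v > 2} \<le> 1"

text \<open>
  Homomorphisms are taken to be extensional functions, so that each map between the vertex sets
  is counted exactly once.
\<close>

definition homs :: "'b pair_pre_digraph \<Rightarrow> 'a pair_pre_digraph \<Rightarrow> ('b \<Rightarrow> 'a) set" where
  "homs H G = {f \<in> pverts H \<rightarrow>\<^sub>E pverts G. \<forall>(u, v) \<in> parcs H. (f u, f v) \<in> parcs G}"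

definition hom_count :: "'b pair_pre_digraph \<Rightarrow> 'a pair_pre_digraph \<Rightarrow> nat" where
  "hom_count H G = card (homs H G)"

text \<open>
  Paths are lists of arcs, so their length is the number of edges.
\<close>

definition kc_path :: "'a pair_pre_digraph \<Rightarrow> 'a \<Rightarrow> ('a \<times> 'a) list \<Rightarrow> 'a \<Rightarrow> bool" where
  "kc_path T x p y \<longleftrightarrow> x \<noteq> y \<and> pre_digraph.apath (with_proj T) x p y \<and>
     (\<forall>v \<in> set (pawalk_verts x p) - {x, y}. degree T v = 2)"

text \<open>
  The neighbor z of y on the path p is the tail of the last arc of p.
\<close>

definition kc_transform ::
    "'a pair_pre_digraph \<Rightarrow> 'a \<Rightarrow> ('a \<times> 'a) list \<Rightarrow> 'a \<Rightarrow> 'a pair_pre_digraph" where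
  "kc_transform T x p y =
     (let z = fst (last p); W = neighbors T y - {z} in
      \<lparr> pverts = pverts T,
        parcs = (parcs T - ({y} \<times> W \<union> W \<times> {y})) \<union> ({x} \<times> W \<union> W \<times> {x}) \<rparr>)"

end

theory Submission
  imports Defs
begin

text \<open>
  Let q 0 = x, ..., q k = y be the path of the KC-transformation, let A be the branch of T
  hanging at x and B the branch hanging at y. In T' both branches hang at x = q 0 and y is a leaf.
  Comparing T' with T therefore means comparing the vertex q i, and its mirror image q (k - i), in
  the two trees. Say that a function f' on the vertices of T' dominates a function f on those of T
  if f' is at least f off the path and, for every i in the half of the path next to x,
  f' (q i) is at least f (q i) and f (q (k - i)), while f' (q i) + f' (q (k - i)) is at least
  f (q i) + f (q (k - i)). Domination is a weak majorization of pairs; it survives pointwise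
  products (\<open>dominated_mult\<close>) and implies the inequality between the total sums
  (\<open>dominated_sum\<close>).

  A tree H is pruned leaf by leaf down to a root: each pruned leaf multiplies the weight of its
  neighbour by a sum over neighbours, and the number of homomorphisms becomes a sum of weights over
  the vertices of the target (\<open>hom_sum_absorb_leaf\<close>). If k is even, the centre of the path
  is a vertex and summing over neighbours preserves domination, so every tree H works
  (\<open>hom_sum_mono_even\<close>). If k is odd, the central edge joins a vertex to its own mirror image and
  this step fails. For starlike H, rooted at its centre, the weights that occur are just products of
  numbers of walks of given lengths, so it is enough that the numbers of walks in T' dominate those
  in T (\<open>dominated_walks_odd\<close>, \<open>hom_sum_mono_starlike\<close>).

  This domination is proved by splitting off, for a branch S, the quantity \<open>flux S n i\<close>: the number of
  walks of length n from q i which run inside the path to x and there step to a vertex of S, minus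
  the number of those which run to y and step to S from there, where after that step the walk is
  counted as a walk of T. Simple recursions give
  w (q (k - i)) - w (q i) = flux B i - flux A i for the walk numbers w of T, and
  w' (q i) \<ge> w (q i) + flux B i for those of T' (\<open>walks_excess\<close>), and everything follows
  once the fluxes are nonnegative on the half of the path next to x.

  Nonnegativity is the heart of the matter (\<open>skew_walks_ge_central_bound\<close>). The flux
  is a convolution in time of the signed kernel D i = G i 0 - G i k, where G s t counts walks in
  the path 0, ..., k, with the numbers of walks of T from vertices of S. For walks in the bare path
  this convolution can be computed: with k = 2 m + 1 and i, d \<le> m, the convolution of D i with the number of walks
  starting at position d counts walks of length n + 1 in the path, from m - d, ..., m to m + 1 + i or
  m + 2 + i, so it is nonnegative. The tree T satisfies the same recursion, only with more neighbours
  in the sum, so the value for the path is a lower bound provided each vertex v is given a position d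
  such that v has one neighbour of position at least d + 1 (capped at m) and, if d > 0, another one of
  position at least d - 1. The height of v in the tree rooted at the central edge does this.
\<close>

section \<open>Counting walks in a bare path\<close>

text \<open>
  Walks in the path graph on the integers 0, ..., k. Positions are integers, and counts vanish outside the
  path, so that the recursions need no boundary cases.
\<close>

primrec path_walks :: "int \<Rightarrow> nat \<Rightarrow> int \<Rightarrow> int \<Rightarrow> int" where
  "path_walks k 0 s t = (if s = t \<and> 0 \<le> s \<and> s \<le> k then 1 else 0)"
| "path_walks k (Suc n) s t =
     (if 0 \<le> s \<and> s \<le> k then path_walks k n (s - 1) t + path_walks k n (s + 1) t else 0)"

lemma path_walks_nonneg: "0 \<le> path_walks k n s t"
  by (induction n arbitrary: s) auto

lemma path_walks_start_outside: "\<not> (0 \<le> s \<and> s \<le> k) \<Longrightarrow> path_walks k n s t = 0"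
  by (cases n) auto

lemma path_walks_end_outside: "\<not> (0 \<le> t \<and> t \<le> k) \<Longrightarrow> path_walks k n s t = 0"
  by (induction n arbitrary: s) auto

lemma path_walks_last_step:
  "0 \<le> t \<Longrightarrow> t \<le> k \<Longrightarrow>
     path_walks k (Suc n) s t = path_walks k n s (t - 1) + path_walks k n s (t + 1)"
proof (induction n arbitrary: s)
  case 0
  then show ?case by auto
next
  case (Suc n)
  show ?case
    by (subst path_walks.simps(2), subst (1 2) Suc.IH) (use Suc.prems in auto)
qed

lemma path_walks_reflect: "path_walks k n (k - s) (k - t) = path_walks k n s t"
proof (induction n arbitrary: s)
  case (Suc n)
  have "k - s - 1 = k - (s + 1)" "k - s + 1 = k - (s - 1)" by simp_all
  then show ?case by (simp only: path_walks.simps Suc.IH) auto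
qed auto

text \<open>
  The kernel that is antisymmetric under reflection of the path: a unit source at 0 and its
  negative at k.
\<close>

definition skew :: "int \<Rightarrow> nat \<Rightarrow> int \<Rightarrow> int" where
  "skew k n i = path_walks k n i 0 - path_walks k n i k"

lemma skew_outside: "\<not> (0 \<le> i \<and> i \<le> k) \<Longrightarrow> skew k n i = 0"
  by (simp add: skew_def path_walks_start_outside)

lemma skew_Suc: "0 \<le> i \<Longrightarrow> i \<le> k \<Longrightarrow> skew k (Suc n) i = skew k n (i - 1) + skew k n (i + 1)"
  by (simp add: skew_def)

lemma skew_antisym: "skew k n (k - i) = - skew k n i"
  using path_walks_reflect[of k n i 0] path_walks_reflect[of k n i k] by (simp add: skew_def)

lemma skew_0: "0 < k \<Longrightarrow> skew k 0 i = (if i = 0 then 1 else if i = k then -1 else 0)"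
  by (simp add: skew_def)

text \<open>
  The source at one end and its mirror image at the other end can be traded for a dipole on the
  central edge, observed at the mirrored position: both sides satisfy the same recursion in
  n and i and both are antisymmetric about the centre. The value i = -1, where both sides vanish,
  is included because it is the boundary value in the recursion at i = 0.
\<close>

lemma skew_eq_central:
  fixes m :: nat
  defines "k \<equiv> 2 * int m + 1"
  assumes "-1 \<le> i" "i \<le> int m"
  shows "skew k n i =
    (path_walks k n (int m + 1) (int m + 1 + i) - path_walks k n (int m) (int m + 1 + i)) +
    (path_walks k n (int m + 1) (int m + 2 + i) - path_walks k n (int m) (int m + 2 + i))"
  using assms(2,3)
proof (induction n arbitrary: i)
  case 0
  then show ?case by (auto simp: skew_def k_def)
next
  case (Suc n)
  define A where "A n t = path_walks k n (int m + 1) t - path_walks k n (int m) t" for n t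
  have IH: "skew k n i = A n (int m + 1 + i) + A n (int m + 2 + i)"
    if "-1 \<le> i" "i \<le> int m" for i
    using Suc.IH[OF that] by (simp add: A_def)
  have A_Suc: "A (Suc n) t = A n (t - 1) + A n (t + 1)" if "0 \<le> t" "t \<le> k" for t
    using that by (simp only: A_def path_walks_last_step)
  have A_out: "A n t = 0" if "\<not> (0 \<le> t \<and> t \<le> k)" for n t
    using that path_walks_end_outside[of t k n] by (simp add: A_def)
  have A_anti: "A n (k - t) = - A n t" for n t
    using path_walks_reflect[of k n "int m" t] path_walks_reflect[of k n "int m + 1" t]
    by (simp add: A_def k_def)
  consider "i = -1" | "0 \<le> i" "i < int m" | "0 \<le> i" "i = int m" using Suc.prems by linarith
  then have "skew k (Suc n) i = A (Suc n) (int m + 1 + i) + A (Suc n) (int m + 2 + i)"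
  proof cases
    case 1
    then show ?thesis using A_anti[of "Suc n" "int m"] by (simp add: skew_def k_def add.commute)
  next
    case 2
    then have "skew k (Suc n) i = skew k n (i - 1) + skew k n (i + 1)"
      by (intro skew_Suc) (auto simp: k_def)
    also have "\<dots> = A n (int m + i) + A n (int m + 1 + i) + A n (int m + 2 + i) + A n (int m + 3 + i)"
      using 2 by (simp add: IH algebra_simps)
    also have "\<dots> = A (Suc n) (int m + 1 + i) + A (Suc n) (int m + 2 + i)"
      using 2 A_Suc[of "int m + 1 + i"] A_Suc[of "int m + 2 + i"] by (simp add: k_def algebra_simps)
    finally show ?thesis .
  next
    case 3
    have "skew k (Suc n) i = skew k n (i - 1) + skew k n (i + 1)"
      using 3 by (intro skew_Suc) (auto simp: k_def)
    also have "skew k n (i + 1) = - skew k n i"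
      using skew_antisym[of k n i] 3 by (simp add: k_def algebra_simps)
    also have "skew k n (i - 1) + - skew k n i = A n (int m + i) - A n (int m + 2 + i)"
      using 3 by (simp add: IH algebra_simps)
    also have "\<dots> = A (Suc n) (int m + 1 + i) + A (Suc n) (int m + 2 + i)"
      using 3 A_Suc[of "int m + 1 + i"] A_out[of "int m + 2 + i"]
      by (simp add: k_def algebra_simps)
    finally show ?thesis .
  qed
  then show ?case by (simp add: A_def)
qed

definition central_walks :: "nat \<Rightarrow> nat \<Rightarrow> int \<Rightarrow> int \<Rightarrow> int" where
  "central_walks m n i s = path_walks (2 * int m + 1) (Suc n) s (int m + 1 + i)
     + path_walks (2 * int m + 1) (Suc n) s (int m + 2 + i)"

text \<open>
  For i and d between 0 and m this is the convolution in time of \<open>skew (2 * m + 1) s i\<close> with the number of walks in the path that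
  start at position d; the recursion \<open>central_bound_Suc\<close> is the one which that convolution
  obeys. Written as a count of walks it is visibly nonnegative.
\<close>

definition central_bound :: "nat \<Rightarrow> nat \<Rightarrow> int \<Rightarrow> nat \<Rightarrow> int" where
  "central_bound m n i d = (\<Sum>l\<le>d. central_walks m n i (int m - int l))"

lemma central_walks_nonneg: "0 \<le> central_walks m n i s"
  unfolding central_walks_def by (intro add_nonneg_nonneg path_walks_nonneg)

lemma central_bound_nonneg: "0 \<le> central_bound m n i d"
  unfolding central_bound_def by (intro sum_nonneg central_walks_nonneg)

lemma central_walks_Suc:
  "0 \<le> s \<Longrightarrow> s \<le> 2 * int m + 1 \<Longrightarrow>
     central_walks m (Suc n) i s = central_walks m n i (s - 1) + central_walks m n i (s + 1)"
  unfolding central_walks_def by (subst (1 2) path_walks.simps(2)) simp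

text \<open>
  The additional summand counts walks that start outside the path, at -1. In terms of the convolution, the
  central positions m and m + 1 are mirror images of each other.
\<close>

lemma central_bound_capped: "central_bound m n i (Suc m) = central_bound m n i m"
  by (simp add: central_bound_def central_walks_def)

lemma central_bound_0:
  assumes "0 \<le> i" "i \<le> int m" "d \<le> m"
  shows "central_bound m 0 i d = skew (2 * int m + 1) 0 i"
proof -
  have "central_walks m 0 i (int m - int l) = (if l = 0 \<and> i = 0 then 1 else 0)" if "l \<le> d" for l
    using that assms by (auto simp: central_walks_def)
  then have "central_bound m 0 i d = (\<Sum>l\<le>d. if l = 0 then (if i = 0 then 1 else 0) else 0)"
    unfolding central_bound_def by (intro sum.cong) auto
  then show ?thesis using assms by (simp add: skew_0)
qed

text \<open>
  Summing the first-step recursion over the starting points m - d, ..., m telescopes. What is left over at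
  the centre is a difference of counts from m + 1 and from m, which is the kernel by
  \<open>skew_eq_central\<close>.
\<close>

lemma central_bound_Suc:
  assumes "0 \<le> i" "i \<le> int m" "d \<le> m"
  shows "central_bound m (Suc n) i d = skew (2 * int m + 1) (Suc n) i
           + (if d = 0 then 0 else central_bound m n i (d - 1)) + central_bound m n i (Suc d)"
  using assms(3)
proof (induction d)
  have sk: "skew (2 * int m + 1) (Suc n) i = central_walks m n i (int m + 1) - central_walks m n i (int m)"
    using assms skew_eq_central[of i m "Suc n"] unfolding central_walks_def by linarith
  case 0
  show ?case using central_walks_Suc[of "int m" m n i] by (simp add: central_bound_def sk)
next
  case (Suc d)
  have "central_bound m (Suc n) i (Suc d)
     = central_bound m (Suc n) i d + central_walks m (Suc n) i (int m - int (Suc d))"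
    by (simp add: central_bound_def)
  also have "central_walks m (Suc n) i (int m - int (Suc d))
     = central_walks m n i (int m - int (Suc (Suc d))) + central_walks m n i (int m - int d)"
    using Suc.prems by (subst central_walks_Suc) (auto simp: algebra_simps)
  also have "central_bound m (Suc n) i d = skew (2 * int m + 1) (Suc n) i
           + (if d = 0 then 0 else central_bound m n i (d - 1)) + central_bound m n i (Suc d)"
    using Suc by simp
  finally show ?case
    by (cases d) (simp_all add: central_bound_def)
qed

section \<open>Walks in a graph against the antisymmetric path kernel\<close>

primrec walks_from :: "('v \<Rightarrow> 'v set) \<Rightarrow> nat \<Rightarrow> 'v \<Rightarrow> nat" where
  "walks_from N 0 v = 1"
| "walks_from N (Suc n) v = (\<Sum>u\<in>N v. walks_from N n u)"

text \<open>
  The convolution of \<open>skew k s i\<close> with \<open>walks_from N (n - s) v\<close> over s \<le> n, given by its recursion in v.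
  The recursion in i is \<open>skew_walks_path_step\<close>.
\<close>

primrec skew_walks :: "int \<Rightarrow> ('v \<Rightarrow> 'v set) \<Rightarrow> nat \<Rightarrow> int \<Rightarrow> 'v \<Rightarrow> int" where
  "skew_walks k N 0 i v = skew k 0 i"
| "skew_walks k N (Suc n) i v = skew k (Suc n) i + (\<Sum>u\<in>N v. skew_walks k N n i u)"

lemma skew_walks_outside: "\<not> (0 \<le> i \<and> i \<le> k) \<Longrightarrow> skew_walks k N n i v = 0"
  by (induction n arbitrary: v) (simp_all add: skew_outside)

lemma skew_walks_antisym: "skew_walks k N n (k - i) v = - skew_walks k N n i v"
  by (induction n arbitrary: v) (simp_all add: skew_antisym sum_negf)

lemma skew_walks_path_step:
  assumes "0 \<le> i" "i \<le> k"
  shows "skew_walks k N (Suc n) i v =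
    skew k 0 i * int (walks_from N (Suc n) v) + skew_walks k N n (i - 1) v + skew_walks k N n (i + 1) v"
proof (induction n arbitrary: v)
  case 0
  then show ?case using assms by (simp add: skew_Suc mult.commute)
next
  case (Suc n)
  have "skew_walks k N (Suc (Suc n)) i v
      = skew k (Suc (Suc n)) i + (\<Sum>u\<in>N v. skew_walks k N (Suc n) i u)"
    by simp
  also have "\<dots> = skew k (Suc n) (i - 1) + skew k (Suc n) (i + 1)
      + (\<Sum>u\<in>N v. skew k 0 i * int (walks_from N (Suc n) u)
           + skew_walks k N n (i - 1) u + skew_walks k N n (i + 1) u)"
    using assms by (simp only: Suc.IH skew_Suc)
  finally show ?case by (simp add: sum.distrib sum_distrib_left)
qed

definition nonbacktracking_walk :: "('v \<Rightarrow> 'v set) \<Rightarrow> nat \<Rightarrow> (nat \<Rightarrow> 'v) \<Rightarrow> bool" where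
  "nonbacktracking_walk N L Q \<longleftrightarrow> (\<forall>i<L. Q (Suc i) \<in> N (Q i)) \<and> (\<forall>i. Suc i < L \<longrightarrow> Q (Suc (Suc i)) \<noteq> Q i)"

text \<open>
  Think of the tree rooted at the edge ab. A non-backtracking walk that ends by crossing this
  edge climbs to the root, so a vertex at index j \<ge> d of it has a descendant at distance d.
  Defined by walks, the notion needs no rooting and makes sense in every graph.
\<close>

definition has_height :: "('v \<Rightarrow> 'v set) \<Rightarrow> 'v \<Rightarrow> 'v \<Rightarrow> nat \<Rightarrow> 'v \<Rightarrow> bool" where
  "has_height N a b d v \<longleftrightarrow> (\<exists>Q L j. nonbacktracking_walk N (Suc L) Q \<and>
     {Q L, Q (Suc L)} = {a, b} \<and> d \<le> j \<and> j \<le> L \<and> Q j = v)"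

lemma has_height_mono: "has_height N a b d v \<Longrightarrow> d' \<le> d \<Longrightarrow> has_height N a b d' v"
  unfolding has_height_def using order_trans[of d' d] by blast

text \<open>
  The next vertex on the climbing walk is higher by one, and the previous one is a different
  neighbour, lower by one. At the end of the walk the next vertex is a or b, which has height m.
\<close>

lemma has_height_neighbors:
  assumes h: "has_height N a b d v" and sym: "\<And>u v. u \<in> N v \<Longrightarrow> v \<in> N u"
    and ends: "has_height N a b m a" "has_height N a b m b"
  obtains u where "u \<in> N v" "has_height N a b (min (Suc d) m) u"
    "0 < d \<Longrightarrow> \<exists>t\<in>N v. t \<noteq> u \<and> has_height N a b (d - 1) t"
proof -
  obtain Q L j where Q: "nonbacktracking_walk N (Suc L) Q" "{Q L, Q (Suc L)} = {a, b}"
    "d \<le> j" "j \<le> L" "Q j = v"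
    using h unfolding has_height_def by blast
  have "Q (Suc j) \<in> N v" using Q by (auto simp: nonbacktracking_walk_def)
  moreover have "has_height N a b (min (Suc d) m) (Q (Suc j))"
  proof (cases "j < L")
    case True
    then have "has_height N a b (Suc d) (Q (Suc j))" using Q unfolding has_height_def
      by (metis Suc_leI Suc_le_mono)
    then show ?thesis by (rule has_height_mono) simp
  next
    case False
    then have "Q (Suc j) \<in> {a, b}" using Q by auto
    then have "has_height N a b m (Q (Suc j))" using ends by auto
    then show ?thesis by (rule has_height_mono) simp
  qed
  moreover have "\<exists>t\<in>N v. t \<noteq> Q (Suc j) \<and> has_height N a b (d - 1) t" if "0 < d"
  proof -
    have "0 < j" using that Q(3) by simp
    then obtain j' where j': "j = Suc j'" using gr0_implies_Suc by blast
    have "has_height N a b (d - 1) (Q j')" unfolding has_height_def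
      using Q(1,2,3,4) j' by (intro exI[of _ Q] exI[of _ L] exI[of _ j']) auto
    moreover have "Q (Suc (Suc j')) \<noteq> Q j'" "v \<in> N (Q j')"
      using Q(1,4,5) j' by (auto simp: nonbacktracking_walk_def)
    then have "Q j' \<in> N v" "Q j' \<noteq> Q (Suc j)" using sym j' by auto
    ultimately show ?thesis by blast
  qed
  ultimately show thesis using that by blast
qed

text \<open>
  Both sides satisfy the same recursion, except that on the left the sum over the neighbours of v is replaced
  by two summands, for positions d - 1 and d + 1. A vertex of height d has neighbours that account for these
  two, and all further neighbours contribute nonnegative terms by the case of height 0.
\<close>

lemma skew_walks_ge_central_bound:
  assumes fin: "\<And>v. v \<in> V \<Longrightarrow> finite (N v)" and sub: "\<And>v. v \<in> V \<Longrightarrow> N v \<subseteq> V"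
    and sym: "\<And>u v. u \<in> N v \<Longrightarrow> v \<in> N u"
    and all: "\<And>v. v \<in> V \<Longrightarrow> has_height N a b 0 v"
    and ends: "has_height N a b m a" "has_height N a b m b"
    and i: "0 \<le> i" "i \<le> int m"
    and v: "v \<in> V" "has_height N a b d v" "d \<le> m"
  shows "central_bound m n i d \<le> skew_walks (2 * int m + 1) N n i v"
  using v
proof (induction n arbitrary: v d)
  case 0
  then show ?case using i by (simp add: central_bound_0)
next
  case (Suc n)
  let ?H = "skew_walks (2 * int m + 1) N n i"
  have nonneg: "0 \<le> ?H u" if "u \<in> V" for u
    using Suc.IH[OF that all[OF that]] central_bound_nonneg[of m n i 0] by linarith
  obtain u where u: "u \<in> N v" "has_height N a b (min (Suc d) m) u"
    "0 < d \<Longrightarrow> \<exists>t\<in>N v. t \<noteq> u \<and> has_height N a b (d - 1) t"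
    using has_height_neighbors[OF Suc.prems(2) sym ends] by blast
  have "central_bound m n i (Suc d) = central_bound m n i (min (Suc d) m)"
    using Suc.prems(3) by (cases "d = m") (auto simp: central_bound_capped min_def)
  also have "\<dots> \<le> ?H u" using Suc.IH[of u "min (Suc d) m"] u sub Suc.prems by auto
  finally have up: "central_bound m n i (Suc d) \<le> ?H u" .
  have "(if d = 0 then 0 else central_bound m n i (d - 1)) + central_bound m n i (Suc d) \<le> (\<Sum>u\<in>N v. ?H u)"
  proof (cases "d = 0")
    case True
    have "?H u \<le> (\<Sum>u\<in>N v. ?H u)"
      using u(1) fin sub nonneg Suc.prems(1) by (intro member_le_sum) auto
    then show ?thesis using up True by simp
  next
    case False
    then obtain t where t: "t \<in> N v" "t \<noteq> u" "has_height N a b (d - 1) t" using u(3) by auto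
    have "?H t + ?H u = sum ?H {t, u}" using t by simp
    also have "\<dots> \<le> (\<Sum>u\<in>N v. ?H u)"
      using t u(1) fin sub nonneg Suc.prems(1) by (intro sum_mono2) auto
    finally have "?H t + ?H u \<le> (\<Sum>u\<in>N v. ?H u)" .
    moreover have "central_bound m n i (d - 1) \<le> ?H t"
      using Suc.IH[of t "d - 1"] t sub[OF Suc.prems(1)] Suc.prems(3) by (simp add: subset_iff)
    ultimately show ?thesis using up False by simp
  qed
  then show ?case using central_bound_Suc[OF i Suc.prems(3), of n] by simp
qed

text \<open>
  A walk that reaches the edge ab is made non-backtracking by cancelling each backtracking step as it
  arises.
\<close>

lemma has_height_0_reachable:
  assumes sym: "\<And>u v. u \<in> N v \<Longrightarrow> v \<in> N u" and ab: "b \<in> N a"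
    and reach: "(v, a) \<in> {(u, w). w \<in> N u}\<^sup>*"
  shows "has_height N a b 0 v"
proof -
  have "\<exists>Q L. nonbacktracking_walk N (Suc L) Q \<and> {Q L, Q (Suc L)} = {a, b} \<and> Q 0 = v"
    using reach
  proof (induction rule: converse_rtrancl_induct)
    case base
    show ?case using ab
      by (intro exI[of _ "\<lambda>i. if i = 0 then a else b"] exI[of _ 0])
        (auto simp: nonbacktracking_walk_def)
  next
    case (step v w)
    then obtain Q L where Q: "nonbacktracking_walk N (Suc L) Q" "{Q L, Q (Suc L)} = {a, b}" "Q 0 = w"
      by blast
    have vw: "w \<in> N v" using step by simp
    show ?case
    proof (cases "Q (Suc 0) = v")
      case False
      have "nonbacktracking_walk N (Suc (Suc L)) (case_nat v Q)"
        using Q vw False by (auto simp: nonbacktracking_walk_def split: nat.split)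
      then show ?thesis using Q(2)
        by (intro exI[of _ "case_nat v Q"] exI[of _ "Suc L"]) auto
    next
      case True
      show ?thesis
      proof (cases L)
        case 0
        then have "{v, w} = {a, b}" using Q True by auto
        then show ?thesis using vw
          by (intro exI[of _ "\<lambda>i. if i = 0 then v else w"] exI[of _ 0])
            (auto simp: nonbacktracking_walk_def)
      next
        case (Suc L')
        then show ?thesis using Q True
          by (intro exI[of _ "\<lambda>i. Q (Suc i)"] exI[of _ L']) (auto simp: nonbacktracking_walk_def)
      qed
    qed
  qed
  then show ?thesis unfolding has_height_def by blast
qed

section \<open>A product inequality for dominated pairs\<close>

text \<open>
  The part of d that b does not cover is covered by the surplus of a over c. Multiplying out, each piece of
  d * d' is then found in a * a' + b * b' beyond the term c * c'.
\<close>

lemma weak_majorization_mult_sorted: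
  fixes a b c d a' b' c' d' :: nat
  assumes "d \<le> c" "c \<le> a" "c + d \<le> a + b" and "d' \<le> c'" "c' \<le> a'" "c' + d' \<le> a' + b'"
  shows "c * c' + d * d' \<le> a * a' + b * b'"
proof -
  \<comment> \<open>Split d into a part s covered by the surplus e of a and a part t covered by b.\<close>
  define e e' s s' where "e = a - c" "e' = a' - c'" "s = min e d" "s' = min e' d'"
  define t t' where "t = d - s" "t' = d' - s'"
  note defs = e_e'_s_s'_def t_t'_def
  have e: "a = c + e" "a' = c' + e'" using assms(2,5) by (simp_all add: defs)
  have s: "d = s + t" "s \<le> e" "t \<le> b" using assms(2,3) by (auto simp: defs)
  have s': "d' = s' + t'" "s' \<le> e'" "t' \<le> b'" using assms(5,6) by (auto simp: defs)
  have "d * d' = s * d' + t * s' + t * t'" by (simp add: s(1) s'(1) algebra_simps)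
  also have "\<dots> \<le> e * c' + c * e' + b * b'"
  proof (intro add_mono mult_le_mono)
    show "t \<le> c" using s(1) assms(1) by linarith
  qed (fact s s' assms)+
  finally show ?thesis by (simp add: e algebra_simps)
qed

lemma rearrangement_nat:
  fixes c d c' d' :: nat
  shows "c * c' + d * d' \<le> max c d * max c' d' + min c d * min c' d'"
proof -
  have *: "c * c' + d * d' \<le> c * d' + d * c'" if "d \<le> c" "c' \<le> d'" for c d c' d' :: nat
  proof -
    have "c = d + (c - d)" "d' = c' + (d' - c')" using that by simp_all
    then obtain e e' where "c = d + e" "d' = c' + e'" by metis
    then show ?thesis by (simp add: algebra_simps)
  qed
  show ?thesis
    using *[of d c c' d'] *[of c d d' c'] by (auto simp: max_def min_def)
qed

text \<open>
  By the rearrangement inequality it is enough to treat pairs that are sorted in the same direction.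
\<close>

lemma weak_majorization_mult:
  fixes a b c d a' b' c' d' :: nat
  assumes "c \<le> a" "d \<le> a" "c + d \<le> a + b" and "c' \<le> a'" "d' \<le> a'" "c' + d' \<le> a' + b'"
  shows "c * c' + d * d' \<le> a * a' + b * b'"
proof -
  have "max c d * max c' d' + min c d * min c' d' \<le> a * a' + b * b'"
    using assms by (intro weak_majorization_mult_sorted) (auto simp: max_def min_def)
  then show ?thesis using rearrangement_nat[of c c' d d'] by linarith
qed

section \<open>The two trees of a KC-transformation\<close>

text \<open>
  The neighbourhood functions N of T and N' of its KC-transformation, on the common vertex set V. The path is
  q 0, ..., q k, and NA and NB are the neighbours of its end vertices q 0 and q k off the path.
  That T is a tree enters through the disjointness conditions on NA and NB: the path has no chords,
  and no vertex outside is adjacent to both of its ends.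
\<close>

locale kc_move =
  fixes V :: "'v set" and N N' :: "'v \<Rightarrow> 'v set" and q :: "nat \<Rightarrow> 'v" and k :: nat
    and NA NB :: "'v set"
  assumes finite_V: "finite V" and N_sub: "v \<in> V \<Longrightarrow> N v \<subseteq> V"
    and N_sym: "u \<in> N v \<Longrightarrow> v \<in> N u"
    and k_pos: "0 < k" and q_inj: "inj_on q {..k}" and q_in_V: "i \<le> k \<Longrightarrow> q i \<in> V"
    and N_inner: "0 < i \<Longrightarrow> i < k \<Longrightarrow> N (q i) = {q (i - 1), q (i + 1)}"
    and N_x: "N (q 0) = insert (q 1) NA" and N_y: "N (q k) = insert (q (k - 1)) NB"
    and A_off: "NA \<inter> q ` {..k} = {}" and B_off: "NB \<inter> q ` {..k} = {}"
    and AB_disj: "NA \<inter> NB = {}"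
    and N'_inner: "0 < i \<Longrightarrow> i < k \<Longrightarrow> N' (q i) = N (q i)"
    and N'_x: "N' (q 0) = insert (q 1) (NA \<union> NB)" and N'_y: "N' (q k) = {q (k - 1)}"
    and N'_off: "v \<in> V \<Longrightarrow> v \<notin> q ` {..k} \<Longrightarrow>
      N' v = (if q k \<in> N v then insert (q 0) (N v - {q k}) else N v)"
    and N'_sub: "v \<in> V \<Longrightarrow> N' v \<subseteq> V" and N'_sym: "u \<in> N' v \<Longrightarrow> v \<in> N' u"
begin

abbreviation P :: "'v set" where "P \<equiv> q ` {..k}"

lemma q_eq [simp]: "i \<le> k \<Longrightarrow> j \<le> k \<Longrightarrow> q i = q j \<longleftrightarrow> i = j"
  using q_inj by (auto simp: inj_on_def)

lemma finite_N: "v \<in> V \<Longrightarrow> finite (N v)"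
  using finite_subset[OF N_sub finite_V] .

lemma NA_V: "NA \<subseteq> V - P" and NB_V: "NB \<subseteq> V - P"
  using N_sub[OF q_in_V[of 0]] N_sub[OF q_in_V[of k]] N_x N_y A_off B_off by auto

lemma finite_NA: "finite NA" and finite_NB: "finite NB"
  using NA_V NB_V finite_V by (meson finite_Diff finite_subset)+

lemma sum_inner:
  fixes f :: "'v \<Rightarrow> 'b::comm_monoid_add"
  assumes "0 < i" "i < k" shows "sum f (N (q i)) = f (q (i - 1)) + f (q (i + 1))"
  using assms by (subst N_inner) auto

lemma sum_x: "sum f (N (q 0)) = f (q 1) + sum f NA"
  and sum_y: "sum f (N (q k)) = f (q (k - 1)) + sum f NB"
  and sum_x': "sum f (N' (q 0)) = f (q 1) + sum f NA + sum f NB"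
  for f :: "'v \<Rightarrow> 'b::comm_monoid_add"
proof -
  have "q 1 \<in> P" "q (k - 1) \<in> P" using k_pos by auto
  then have *: "q 1 \<notin> NA" "q 1 \<notin> NB" "q (k - 1) \<notin> NB" using A_off B_off by blast+
  show "sum f (N (q 0)) = f (q 1) + sum f NA" "sum f (N (q k)) = f (q (k - 1)) + sum f NB"
    using * finite_NA finite_NB by (simp_all add: N_x N_y)
  show "sum f (N' (q 0)) = f (q 1) + sum f NA + sum f NB"
    using * finite_NA finite_NB AB_disj by (simp add: N'_x sum.union_disjoint add.assoc)
qed

lemma off_path_neighbor:
  assumes "v \<in> V - P" "u \<in> N v"
  shows "u \<in> V - P \<or> u = q 0 \<or> u = q k"
proof (cases "u \<in> P")
  case True
  then obtain i where i: "i \<le> k" "u = q i" by auto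
  have "v \<in> N (q i)" using N_sym assms(2) i by blast
  then show ?thesis using N_inner[of i] assms(1) i by (cases "0 < i \<and> i < k") auto
qed (use assms N_sub in auto)

lemma off_path_not_both:
  assumes "v \<in> V - P" "q k \<in> N v" shows "q 0 \<notin> N v"
proof
  assume "q 0 \<in> N v"
  then have "v \<in> N (q 0)" "v \<in> N (q k)" using assms N_sym by blast+
  moreover have "v \<noteq> q 1" "v \<noteq> q (k - 1)" using assms k_pos by auto
  ultimately have "v \<in> NA" "v \<in> NB" by (auto simp: N_x N_y)
  then show False using AB_disj by blast
qed

text \<open>
  The condition concerns the pairs q i, q (k - i). For i = k - i it reduces to f (q i) \<le> f' (q i).
\<close>

definition dominated :: "('v \<Rightarrow> nat) \<Rightarrow> ('v \<Rightarrow> nat) \<Rightarrow> bool" where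
  "dominated f f' \<longleftrightarrow> (\<forall>v\<in>V - P. f v \<le> f' v) \<and>
     (\<forall>i. 2 * i \<le> k \<longrightarrow> f (q i) \<le> f' (q i) \<and> f (q (k - i)) \<le> f' (q i) \<and>
        f (q i) + f (q (k - i)) \<le> f' (q i) + f' (q (k - i)))"

lemma dominatedD:
  assumes "dominated f f'"
  shows "v \<in> V - P \<Longrightarrow> f v \<le> f' v"
    and "2 * i \<le> k \<Longrightarrow> f (q i) \<le> f' (q i)"
    and "2 * i \<le> k \<Longrightarrow> f (q (k - i)) \<le> f' (q i)"
    and "2 * i \<le> k \<Longrightarrow> f (q i) + f (q (k - i)) \<le> f' (q i) + f' (q (k - i))"
  using assms unfolding dominated_def by blast+

lemma dominated_const: "dominated (\<lambda>_. c) (\<lambda>_. c)"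
  by (simp add: dominated_def)


lemma dominated_mult:
  assumes f: "dominated f f'" and g: "dominated g g'"
  shows "dominated (\<lambda>v. f v * g v) (\<lambda>v. f' v * g' v)"
  unfolding dominated_def
proof (intro conjI ballI allI impI)
  fix i assume i: "2 * i \<le> k"
  show "f (q i) * g (q i) + f (q (k - i)) * g (q (k - i))
      \<le> f' (q i) * g' (q i) + f' (q (k - i)) * g' (q (k - i))"
    by (intro weak_majorization_mult dominatedD[OF f] dominatedD[OF g] i)
qed (auto intro!: mult_le_mono dominatedD[OF f] dominatedD[OF g])

text \<open>
  Domination compares the sums over pairs of mirror images; summing over all i counts every
  vertex of the path twice.
\<close>

lemma dominated_sum:
  assumes "dominated f f'" shows "sum f V \<le> sum f' V"
proof -
  have pair: "f (q i) + f (q (k - i)) \<le> f' (q i) + f' (q (k - i))" if "i \<le> k" for i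
  proof (cases "2 * i \<le> k")
    case False
    then have "2 * (k - i) \<le> k" by linarith
    then show ?thesis using dominatedD(4)[OF assms, of "k - i"] that by (simp add: add.commute)
  qed (rule dominatedD(4)[OF assms])
  have double: "2 * sum h P = (\<Sum>i\<le>k. h (q i) + h (q (k - i)))" for h :: "'v \<Rightarrow> nat"
  proof -
    have "sum h P = (\<Sum>i\<le>k. h (q i))" using q_inj by (simp add: sum.reindex)
    moreover have "(\<Sum>i\<le>k. h (q (k - i))) = (\<Sum>i\<le>k. h (q i))"
      using sum.nat_diff_reindex[of "\<lambda>i. h (q i)" "Suc k"] by (simp add: lessThan_Suc_atMost)
    ultimately show ?thesis by (simp add: sum.distrib)
  qed
  have "2 * sum f P \<le> 2 * sum f' P"
    unfolding double by (intro sum_mono pair) auto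
  moreover have "sum f (V - P) \<le> sum f' (V - P)" by (intro sum_mono dominatedD(1)[OF assms])
  moreover have "sum h V = sum h (V - P) + sum h P" for h :: "'v \<Rightarrow> nat"
    using q_in_V finite_V by (intro sum.subset_diff) auto
  ultimately show ?thesis by simp
qed

text \<open>
  Off the path the neighbourhoods in T and T' agree, except that y is replaced by x.
\<close>

lemma off_path_step:
  fixes f f' :: "'v \<Rightarrow> nat"
  assumes v: "v \<in> V - P" and off: "\<And>u. u \<in> V - P \<Longrightarrow> f u \<le> f' u"
    and x: "f (q 0) \<le> f' (q 0)" and y: "f (q k) \<le> f' (q 0)"
  shows "sum f (N v) \<le> sum f' (N' v)"
proof (cases "q k \<in> N v")
  case False
  have "f u \<le> f' u" if "u \<in> N v" for u
    using off_path_neighbor[OF v that] off[of u] x False that by auto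
  then have "sum f (N v) \<le> sum f' (N v)" by (rule sum_mono)
  then show ?thesis using N'_off v False by auto
next
  case True
  have fin: "finite (N v)" using v finite_N by blast
  have "sum f (N v) = f (q k) + sum f (N v - {q k})" using True fin by (simp add: sum.remove)
  also have "\<dots> \<le> f' (q 0) + sum f' (N v - {q k})"
  proof (intro add_mono sum_mono y)
    fix u assume "u \<in> N v - {q k}"
    then show "f u \<le> f' u"
      using off_path_neighbor[OF v, of u] off[of u] off_path_not_both[OF v True] by auto
  qed
  also have "\<dots> = sum f' (N' v)"
    using N'_off v True off_path_not_both[OF v True] fin by auto
  finally show ?thesis .
qed

text \<open>
  For even k the neighbours on the path of a vertex in the half next to x lie in the same half, unless it is
  the central vertex, whose two neighbours are mirror images of each other. At the ends, x collects in T' the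
  sums over both branches, which in T are divided between x and y.
\<close>

lemma dominated_step_even:
  assumes "even k" and f: "dominated f f'"
  shows "dominated (\<lambda>v. sum f (N v)) (\<lambda>v. sum f' (N' v))"
  unfolding dominated_def
proof (intro conjI ballI)
  fix v assume "v \<in> V - P"
  then show "sum f (N v) \<le> sum f' (N' v)"
    using dominatedD[OF f] dominatedD(2,3)[OF f, of 0] by (intro off_path_step) auto
next
  have k2: "2 \<le> k" using k_pos \<open>even k\<close> by presburger
  have sA: "sum f NA \<le> sum f' NA" and sB: "sum f NB \<le> sum f' NB"
    using NA_V NB_V by (auto intro!: sum_mono dominatedD(1)[OF f])
  show "\<forall>i. 2 * i \<le> k \<longrightarrow> sum f (N (q i)) \<le> sum f' (N' (q i)) \<and>
        sum f (N (q (k - i))) \<le> sum f' (N' (q i)) \<and>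
        sum f (N (q i)) + sum f (N (q (k - i))) \<le> sum f' (N' (q i)) + sum f' (N' (q (k - i)))"
  proof (intro allI impI)
    fix i assume i: "2 * i \<le> k"
    consider "i = 0" | "0 < i" "2 * i < k" | "0 < i" "2 * i = k" using i by linarith
    then show "sum f (N (q i)) \<le> sum f' (N' (q i)) \<and>
        sum f (N (q (k - i))) \<le> sum f' (N' (q i)) \<and>
        sum f (N (q i)) + sum f (N (q (k - i))) \<le> sum f' (N' (q i)) + sum f' (N' (q (k - i)))"
    proof cases
      case 1
      then show ?thesis using sA sB dominatedD(2-4)[OF f, of 1] k2
        by (auto simp: sum_x sum_y sum_x' N'_y)
    next
      case 2
      have "2 * (i + 1) \<le> k" "2 * (i - 1) \<le> k" using 2 \<open>even k\<close> by presburger+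
      moreover have "k - (i - 1) = k - i + 1" "k - (i + 1) = k - i - 1" using 2 by auto
      ultimately show ?thesis
        using dominatedD(2-4)[OF f, of "i - 1"] dominatedD(2-4)[OF f, of "i + 1"] 2
        by (simp add: sum_inner N'_inner)
    next
      case 3
      then have "k - i = i" "k - (i - 1) = i + 1" "2 * (i - 1) \<le> k" by auto
      then show ?thesis
        using dominatedD(4)[OF f, of "i - 1"] 3 by (simp add: sum_inner N'_inner)
    qed
  qed
qed

section \<open>Walks along a path of odd length\<close>

text \<open>
  Walks of length n that run in the path from position i to x and then step into S, minus those that run to y
  and step into S from there; the rest of the walk is counted in T. The first step into S uses up one unit of
  length, so the flux vanishes for n = 0.
\<close>

definition flux :: "'v set \<Rightarrow> nat \<Rightarrow> int \<Rightarrow> int" where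
  "flux S n i = (case n of 0 \<Rightarrow> 0 | Suc n' \<Rightarrow> \<Sum>u\<in>S. skew_walks (int k) N n' i u)"

lemma flux_0 [simp]: "flux S 0 i = 0"
  by (simp add: flux_def)

lemma flux_outside: "\<not> (0 \<le> i \<and> i \<le> int k) \<Longrightarrow> flux S n i = 0"
  by (simp add: flux_def skew_walks_outside split: nat.split)

lemma flux_antisym: "j \<le> k \<Longrightarrow> flux S n (int (k - j)) = - flux S n (int j)"
  by (simp add: flux_def of_nat_diff skew_walks_antisym sum_negf split: nat.split)

lemma flux_Suc:
  assumes "0 \<le> i" "i \<le> int k"
  shows "flux S (Suc n) i = skew (int k) 0 i * int (sum (walks_from N n) S)
           + flux S n (i - 1) + flux S n (i + 1)"
proof (cases n)
  case (Suc n')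
  have "flux S (Suc n) i = (\<Sum>u\<in>S. skew (int k) 0 i * int (walks_from N n u)
      + skew_walks (int k) N n' (i - 1) u + skew_walks (int k) N n' (i + 1) u)"
    unfolding Suc flux_def nat.case by (intro sum.cong refl skew_walks_path_step assms)
  then show ?thesis by (simp add: Suc flux_def sum.distrib sum_distrib_left)
qed (simp add: flux_def)

lemma flux_Suc_inner:
  assumes "0 < j" "j < k"
  shows "flux S (Suc n) (int j) = flux S n (int (j - 1)) + flux S n (int (j + 1))"
proof -
  have "int j - 1 = int (j - 1)" "int j + 1 = int (j + 1)" using assms by auto
  then show ?thesis using flux_Suc[of "int j" S n] assms k_pos by (simp only: skew_0) simp
qed

lemma flux_Suc_x: "flux S (Suc n) 0 = int (sum (walks_from N n) S) + flux S n 1"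
  using flux_Suc[of 0 S n] flux_outside[of "-1"] k_pos by (simp add: skew_0)

lemma flux_Suc_y:
  "flux S (Suc n) (int k) = - int (sum (walks_from N n) S) + flux S n (int (k - 1))"
proof -
  have "int k - 1 = int (k - 1)" using k_pos by auto
  then show ?thesis
    using flux_Suc[of "int k" S n] flux_outside[of "int k + 1"] k_pos by (simp add: skew_0)
qed

text \<open>
  Both sides are antisymmetric and satisfy the same recursion along the path, with the sums of walk numbers
  over NB and NA as sources at the two ends.
\<close>

lemma walks_from_skew:
  "j \<le> k \<Longrightarrow> int (walks_from N n (q (k - j))) - int (walks_from N n (q j))
     = flux NB n (int j) - flux NA n (int j)"
proof (induction n arbitrary: j)
  case (Suc n)
  have x: "int (walks_from N (Suc n) (q k)) - int (walks_from N (Suc n) (q 0))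
     = flux NB (Suc n) 0 - flux NA (Suc n) 0"
    using Suc.IH[of 1] k_pos by (simp add: sum_x sum_y flux_Suc_x)
  consider "j = 0" | "j = k" | "0 < j" "j < k" using Suc.prems by linarith
  then show ?case
  proof cases
    case 1 then show ?thesis using x by simp
  next
    case 2 then show ?thesis using x flux_antisym[of 0 NA] flux_antisym[of 0 NB] by simp
  next
    case 3
    have "k - (j - 1) = k - j + 1" "k - (j + 1) = k - j - 1" "j - 1 \<le> k" using 3 by auto
    then show ?thesis
      using Suc.IH[of "j - 1"] Suc.IH[of "j + 1"] 3
      by (simp add: sum_inner flux_Suc_inner del: of_nat_Suc)
  qed
qed simp

lemma q_step: "i < k \<Longrightarrow> q (Suc i) \<in> N (q i)"
  using N_inner[of i] N_x by (cases "i = 0") auto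

text \<open>
  The edge joining q m and q (m + 1) is the central one. Its ends have height m because of the two halves
  of the path, and all other vertices have height at least 0 as T is connected.
\<close>

lemma flux_nonneg:
  assumes m: "k = 2 * m + 1" and conn: "\<And>v. v \<in> V \<Longrightarrow> (v, q m) \<in> {(u, w). w \<in> N u}\<^sup>*"
    and S: "S \<subseteq> V" and i: "0 \<le> i" "i \<le> int m"
  shows "0 \<le> flux S n i"
proof -
  let ?ht = "has_height N (q m) (q (Suc m))"
  \<comment> \<open>The walks from q 0 and from q k across the centre witness the two heights.\<close>
  have x: "?ht m (q m)" unfolding has_height_def
    by (intro exI[of _ q] exI[of _ m]) (auto simp: nonbacktracking_walk_def q_step m)
  have y: "?ht m (q (Suc m))" unfolding has_height_def
  proof (intro exI[of _ "\<lambda>i. q (k - i)"] exI[of _ m] conjI)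
    have "q (k - Suc i) \<in> N (q (k - i))" if "i < Suc m" for i
    proof -
      have "k - i = Suc (k - Suc i)" using that m by auto
      then show ?thesis using q_step[of "k - Suc i"] N_sym k_pos by simp
    qed
    then show "nonbacktracking_walk N (Suc m) (\<lambda>i. q (k - i))"
      by (auto simp: nonbacktracking_walk_def m)
  qed (auto simp: m)
  have low: "?ht 0 v" if "v \<in> V" for v
    using N_sym q_step[of m] conn[OF that] m by (intro has_height_0_reachable) auto
  have "int k = 2 * int m + 1" using m by simp
  then have "0 \<le> skew_walks (int k) N n i u" if "u \<in> V" for n u
    using skew_walks_ge_central_bound[OF finite_N N_sub N_sym low x y i that low[OF that], of n]
      central_bound_nonneg[of m n i 0] by simp
  then show ?thesis using S by (auto simp: flux_def intro!: sum_nonneg split: nat.split)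
qed

text \<open>
  The difference of the two sides on the path is propagated by the path with nonnegative sources at x only:
  the flux absorbs the signed contribution of moving the branch at y. Off the path the induction needs
  walk numbers at x in T' to be at least those at both x and y in T, which is where the two fluxes have
  to be nonnegative.
\<close>

lemma walks_excess:
  assumes m: "k = 2 * m + 1" and conn: "\<And>v. v \<in> V \<Longrightarrow> (v, q m) \<in> {(u, w). w \<in> N u}\<^sup>*"
  shows "(\<forall>j\<le>k. int (walks_from N n (q j)) + flux NB n (int j) \<le> int (walks_from N' n (q j)))
     \<and> (\<forall>v\<in>V - P. walks_from N n v \<le> walks_from N' n v)"
proof (induction n)
  case (Suc n)
  let ?w = "walks_from N n" and ?w' = "walks_from N' n"
  have on: "int (?w (q j)) + flux NB n (int j) \<le> int (?w' (q j))" if "j \<le> k" for j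
    using Suc that by blast
  have off: "?w v \<le> ?w' v" if "v \<in> V - P" for v
    using Suc that by blast
  have S: "NA \<subseteq> V" "NB \<subseteq> V" using NA_V NB_V by auto
  have sums: "sum ?w NA \<le> sum ?w' NA" "sum ?w NB \<le> sum ?w' NB"
    using NA_V NB_V off by (auto intro!: sum_mono)
  have "0 \<le> flux NA n 0" "0 \<le> flux NB n 0"
    using flux_nonneg[OF m conn S(1), of 0] flux_nonneg[OF m conn S(2), of 0] by auto
  then have "?w (q 0) \<le> ?w' (q 0)" "?w (q k) \<le> ?w' (q 0)"
    using on[of 0] walks_from_skew[of 0 n] by auto
  then have "walks_from N (Suc n) v \<le> walks_from N' (Suc n) v" if "v \<in> V - P" for v
    using off_path_step[OF that, of ?w ?w'] off by simp
  moreover have "int (walks_from N (Suc n) (q j)) + flux NB (Suc n) (int j)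
      \<le> int (walks_from N' (Suc n) (q j))" if j: "j \<le> k" for j
  proof -
    consider "j = 0" | "j = k" "0 < j" | "0 < j" "j < k" using j by linarith
    then show ?thesis
    proof cases
      case 1 then show ?thesis using on[of 1] k_pos sums by (simp add: sum_x sum_x' flux_Suc_x del: of_nat_sum)
    next
      case 2 then show ?thesis using on[of "k - 1"] by (simp add: sum_y N'_y flux_Suc_y)
    next
      case 3
      then have "j - 1 \<le> k" "j + 1 \<le> k" by auto
      then show ?thesis using on[of "j - 1"] on[of "j + 1"] 3
        by (simp add: sum_inner N'_inner flux_Suc_inner del: of_nat_Suc)
    qed
  qed
  ultimately show ?case by blast
qed simp

text \<open>
  The flux of NB gives w' \<ge> w on the half of the path next to x. Exchanging it for the flux of NA by
  \<open>walks_from_skew\<close> compares with the mirror image, and in the sum over a mirror pair the fluxes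
  cancel.
\<close>

lemma dominated_walks_odd:
  assumes m: "k = 2 * m + 1" and conn: "\<And>v. v \<in> V \<Longrightarrow> (v, q m) \<in> {(u, w). w \<in> N u}\<^sup>*"
  shows "dominated (walks_from N n) (walks_from N' n)"
  unfolding dominated_def
proof (intro conjI allI impI)
  let ?w = "walks_from N n" and ?w' = "walks_from N' n"
  show "\<forall>v\<in>V - P. ?w v \<le> ?w' v" using walks_excess[OF assms] by blast
  have on: "int (?w (q j)) + flux NB n (int j) \<le> int (?w' (q j))" if "j \<le> k" for j
    using walks_excess[OF assms] that by blast
  fix i assume i: "2 * i \<le> k"
  have S: "NA \<subseteq> V" "NB \<subseteq> V" using NA_V NB_V by auto
  have nonneg: "0 \<le> flux NA n (int i)" "0 \<le> flux NB n (int i)"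
    using flux_nonneg[OF m conn S(1), of "int i"] flux_nonneg[OF m conn S(2), of "int i"] i m
    by auto
  have "i \<le> k" using i by simp
  note facts = on[of i] on[of "k - i"] walks_from_skew[OF \<open>i \<le> k\<close>, of n]
    flux_antisym[OF \<open>i \<le> k\<close>, of NB n] nonneg \<open>i \<le> k\<close>
  show "?w (q i) \<le> ?w' (q i)" "?w (q (k - i)) \<le> ?w' (q i)"
    "?w (q i) + ?w (q (k - i)) \<le> ?w' (q i) + ?w' (q (k - i))"
    using facts by linarith+
qed

end

section \<open>Homomorphism sums and pruning of leaves\<close>

text \<open>
  Homomorphisms from the graph E on S to the graph N on V, weighted with a factor for the image of each
  vertex. The weights record the parts of the source graph that were pruned already.
\<close>

definition hom_sum :: "('b \<Rightarrow> 'b \<Rightarrow> bool) \<Rightarrow> 'v set \<Rightarrow> ('v \<Rightarrow> 'v set) \<Rightarrow> 'b set \<Rightarrow> ('b \<Rightarrow> 'v \<Rightarrow> nat) \<Rightarrow> nat" where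
  "hom_sum E V N S \<phi> = (\<Sum>f\<in>S \<rightarrow>\<^sub>E V.
     if \<forall>u\<in>S. \<forall>v\<in>S. E u v \<longrightarrow> f v \<in> N (f u) then \<Prod>u\<in>S. \<phi> u (f u) else 0)"

definition absorb_leaf :: "('v \<Rightarrow> 'v set) \<Rightarrow> 'b \<Rightarrow> 'b \<Rightarrow> ('b \<Rightarrow> 'v \<Rightarrow> nat) \<Rightarrow> 'b \<Rightarrow> 'v \<Rightarrow> nat" where
  "absorb_leaf N u v \<phi> = \<phi>(u := \<lambda>a. \<phi> u a * sum (\<phi> v) (N a))"

lemma hom_sum_singleton:
  assumes "\<not> E c c" shows "hom_sum E V N {c} \<phi> = sum (\<phi> c) V"
proof -
  have eq: "{c} \<rightarrow>\<^sub>E V = (\<lambda>a. (\<lambda>_. undefined)(c := a)) ` V"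
    by (subst PiE_insert_eq) (auto simp: PiE_empty_domain image_iff)
  have "inj_on (\<lambda>a. (\<lambda>_. undefined)(c := a)) V"
    by (auto simp: inj_on_def dest: fun_upd_eqD)
  then show ?thesis using assms unfolding hom_sum_def eq by (subst sum.reindex) auto
qed

text \<open>
  Given the image of the remaining vertices, the leaf v may be sent to any neighbour of the
  image of u.
\<close>

lemma hom_sum_absorb_leaf:
  assumes fin: "finite S" "finite V" and N_sub: "\<And>a. a \<in> V \<Longrightarrow> N a \<subseteq> V"
    and N_sym: "\<And>a b. b \<in> N a \<Longrightarrow> a \<in> N b" and E_sym: "\<And>a b. E a b \<Longrightarrow> E b a"
    and E_irrefl: "\<And>a. \<not> E a a" and u: "u \<in> S" "v \<notin> S" "E u v"
    and leaf: "\<And>w. w \<in> S \<Longrightarrow> E w v \<Longrightarrow> w = u"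
  shows "hom_sum E V N (insert v S) \<phi> = hom_sum E V N S (absorb_leaf N u v \<phi>)"
proof -
  let ?hom = "\<lambda>S f. \<forall>u\<in>S. \<forall>v\<in>S. E u v \<longrightarrow> f v \<in> N (f u)"
  let ?ext = "\<lambda>(b, g). g(v := b)"
  have hom_ext: "?hom (insert v S) (g(v := b)) \<longleftrightarrow> ?hom S g \<and> b \<in> N (g u)" for g b
  proof
    assume L: "?hom (insert v S) (g(v := b))"
    have "?hom S g"
    proof (intro ballI impI)
      fix s t assume "s \<in> S" "t \<in> S" "E s t"
      then show "g t \<in> N (g s)" using bspec[OF bspec[OF L, of s], of t] u(2) by (auto split: if_splits)
    qed
    moreover have "b \<in> N (g u)" using bspec[OF bspec[OF L, of u], of v] u by (auto split: if_splits)
    ultimately show "?hom S g \<and> b \<in> N (g u)" by blast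
  next
    assume R: "?hom S g \<and> b \<in> N (g u)"
    show "?hom (insert v S) (g(v := b))"
    proof (intro ballI impI)
      fix s t assume st: "s \<in> insert v S" "t \<in> insert v S" "E s t"
      consider "s \<in> S" "t \<in> S" | "s = v" "t = u" | "s = u" "t = v"
        using st leaf[of s] leaf[of t] E_sym[of s t] E_irrefl[of v] by auto
      then show "(g(v := b)) t \<in> N ((g(v := b)) s)"
        using R st(3) u N_sym[of b "g u"] by cases auto
    qed
  qed
  have prod_ext: "(\<Prod>w\<in>insert v S. \<phi> w ((g(v := b)) w)) = \<phi> v b * (\<Prod>w\<in>S. \<phi> w (g w))" for g b
  proof -
    have "(\<Prod>w\<in>S. \<phi> w ((g(v := b)) w)) = (\<Prod>w\<in>S. \<phi> w (g w))"
      using u(2) by (intro prod.cong) auto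
    then show ?thesis using fin u(2) by simp
  qed
  have prod_upd: "(\<Prod>w\<in>S. absorb_leaf N u v \<phi> w (g w)) = sum (\<phi> v) (N (g u)) * (\<Prod>w\<in>S. \<phi> w (g w))" for g
  proof -
    have "(\<Prod>w\<in>S - {u}. absorb_leaf N u v \<phi> w (g w)) = (\<Prod>w\<in>S - {u}. \<phi> w (g w))"
      by (intro prod.cong) (auto simp: absorb_leaf_def)
    then show ?thesis
      using prod.remove[OF fin(1) u(1), of "\<lambda>w. absorb_leaf N u v \<phi> w (g w)"]
        prod.remove[OF fin(1) u(1), of "\<lambda>w. \<phi> w (g w)"]
      by (simp add: absorb_leaf_def mult_ac)
  qed
  have inj: "inj_on ?ext (V \<times> (S \<rightarrow>\<^sub>E V))"
    using u(2) by (rule inj_combinator)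
  have "hom_sum E V N (insert v S) \<phi> = (\<Sum>(b, g)\<in>V \<times> (S \<rightarrow>\<^sub>E V).
      if ?hom S g \<and> b \<in> N (g u) then \<phi> v b * (\<Prod>w\<in>S. \<phi> w (g w)) else 0)"
    unfolding hom_sum_def PiE_insert_eq sum.reindex[OF inj]
    by (simp only: o_def case_prod_unfold hom_ext prod_ext)
  also have "\<dots> = (\<Sum>g\<in>S \<rightarrow>\<^sub>E V. \<Sum>b\<in>V.
      if ?hom S g \<and> b \<in> N (g u) then \<phi> v b * (\<Prod>w\<in>S. \<phi> w (g w)) else 0)"
    by (subst sum.swap) (simp only: sum.cartesian_product)
  also have "\<dots> = hom_sum E V N S (absorb_leaf N u v \<phi>)"
    unfolding hom_sum_def
  proof (intro sum.cong refl)
    fix g assume g: "g \<in> S \<rightarrow>\<^sub>E V"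
    then have sub: "N (g u) \<subseteq> V" using N_sub u(1) by (auto simp: PiE_iff)
    show "(\<Sum>b\<in>V. if ?hom S g \<and> b \<in> N (g u) then \<phi> v b * (\<Prod>w\<in>S. \<phi> w (g w)) else 0)
        = (if ?hom S g then \<Prod>w\<in>S. absorb_leaf N u v \<phi> w (g w) else 0)"
    proof (cases "?hom S g")
      case True
      have "(\<Sum>b\<in>V. if b \<in> N (g u) then \<phi> v b * (\<Prod>w\<in>S. \<phi> w (g w)) else 0)
          = (\<Sum>b\<in>N (g u). \<phi> v b * (\<Prod>w\<in>S. \<phi> w (g w)))"
        using fin sub by (simp add: sum.inter_restrict[symmetric] Int_absorb1)
      then show ?thesis using True by (simp add: prod_upd sum_distrib_right)
    next
      case False
      then show ?thesis by (simp only: simp_thms if_False sum.neutral_const)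
    qed
  qed
  finally show ?thesis .
qed

text \<open>
  Growing a tree from the root c by attaching one leaf at a time; read backwards, this prunes the
  tree without ever removing c.
\<close>

inductive leaf_growth :: "('b \<Rightarrow> 'b \<Rightarrow> bool) \<Rightarrow> 'b \<Rightarrow> 'b set \<Rightarrow> bool" for E c where
  root: "leaf_growth E c {c}"
| leaf: "leaf_growth E c S \<Longrightarrow> u \<in> S \<Longrightarrow> v \<notin> S \<Longrightarrow> E u v \<Longrightarrow> (\<And>w. w \<in> S \<Longrightarrow> E w v \<Longrightarrow> w = u)
    \<Longrightarrow> leaf_growth E c (insert v S)"

lemma leaf_growth_finite: "leaf_growth E c S \<Longrightarrow> finite S"
  by (induction rule: leaf_growth.induct) auto

lemma leaf_growth_root_in: "leaf_growth E c S \<Longrightarrow> c \<in> S"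
  by (induction rule: leaf_growth.induct) auto

lemma leaf_growth_neighbor:
  assumes "leaf_growth E c S" "\<And>a b. E a b \<Longrightarrow> E b a" "u \<in> S" "u \<noteq> c"
  shows "\<exists>w\<in>S. E u w"
  using assms(1,3)
proof (induction rule: leaf_growth.induct)
  case (leaf S u' v)
  show ?case
  proof (cases "u = v")
    case True
    then show ?thesis using assms(2)[OF leaf.hyps(4)] leaf.hyps(2) by blast
  next
    case False
    then have "u \<in> S" using leaf.prems by simp
    from leaf.IH[OF this] show ?thesis by blast
  qed
qed (use assms(4) in simp)

lemma leaf_growth_path:
  assumes "leaf_growth E c S" and sym: "\<And>a b. E a b \<Longrightarrow> E b a" and "s \<in> S" "t \<in> S"
  shows "\<exists>xs. distinct xs \<and> set xs \<subseteq> S \<and> xs \<noteq> [] \<and> hd xs = s \<and> last xs = t \<and> successively E xs"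
  using assms(1,3,4)
proof (induction arbitrary: s t rule: leaf_growth.induct)
  case root
  then show ?case by (intro exI[of _ "[c]"]) auto
next
  case (leaf S u v)
  consider "s \<in> S" "t \<in> S" | "s = v" "t = v" | "s = v" "t \<in> S" | "s \<in> S" "t = v"
    using leaf.prems by blast
  then show ?case
  proof cases
    case 1
    then obtain xs where "distinct xs" "set xs \<subseteq> S" "xs \<noteq> []" "hd xs = s" "last xs = t"
      "successively E xs" using leaf.IH[OF 1] by metis
    then show ?thesis by (intro exI[of _ xs]) auto
  next
    case 2
    then show ?thesis by (intro exI[of _ "[v]"]) auto
  next
    case 3
    then obtain xs where xs: "distinct xs" "set xs \<subseteq> S" "xs \<noteq> []" "hd xs = u" "last xs = t"
      "successively E xs" using leaf.IH[OF leaf.hyps(2) 3(2)] by metis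
    then show ?thesis using 3 leaf.hyps(3) sym[OF leaf.hyps(4)]
      by (intro exI[of _ "v # xs"]) (auto simp: successively_Cons)
  next
    case 4
    then obtain xs where xs: "distinct xs" "set xs \<subseteq> S" "xs \<noteq> []" "hd xs = s" "last xs = u"
      "successively E xs" using leaf.IH[OF 4(1) leaf.hyps(2)] by metis
    then show ?thesis using 4 leaf.hyps(3,4)
      by (intro exI[of _ "xs @ [v]"]) (auto simp: successively_append_iff)
  qed
qed

context kc_move begin

context
  fixes E :: "'b \<Rightarrow> 'b \<Rightarrow> bool"
  assumes E_sym: "\<And>a b. E a b \<Longrightarrow> E b a" and E_irrefl: "\<And>a. \<not> E a a"
begin

lemma hom_sum_absorb_leaf_both:
  assumes "leaf_growth E c S" "u \<in> S" "v \<notin> S" "E u v" "\<And>w. w \<in> S \<Longrightarrow> E w v \<Longrightarrow> w = u"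
  shows "hom_sum E V N (insert v S) \<phi> = hom_sum E V N S (absorb_leaf N u v \<phi>)"
    and "hom_sum E V N' (insert v S) \<phi> = hom_sum E V N' S (absorb_leaf N' u v \<phi>)"
  by (rule hom_sum_absorb_leaf; fact leaf_growth_finite[OF assms(1)] finite_V N_sub N'_sub N_sym
        N'_sym E_sym E_irrefl assms)+

lemma hom_sum_mono_even:
  assumes "even k" and "leaf_growth E c S" and "\<And>u. u \<in> S \<Longrightarrow> dominated (\<phi> u) (\<phi>' u)"
  shows "hom_sum E V N S \<phi> \<le> hom_sum E V N' S \<phi>'"
  using assms(2,3)
proof (induction arbitrary: \<phi> \<phi>' rule: leaf_growth.induct)
  case root
  then show ?case using E_irrefl dominated_sum by (simp add: hom_sum_singleton)
next
  case (leaf S u v)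
  have "hom_sum E V N S (absorb_leaf N u v \<phi>) \<le> hom_sum E V N' S (absorb_leaf N' u v \<phi>')"
  proof (rule leaf.IH)
    fix s assume "s \<in> S"
    then show "dominated (absorb_leaf N u v \<phi> s) (absorb_leaf N' u v \<phi>' s)"
      using leaf.prems leaf.hyps(2) by (auto simp: absorb_leaf_def intro!: dominated_mult dominated_step_even \<open>even k\<close>)
  qed
  then show ?case using hom_sum_absorb_leaf_both[OF leaf.hyps] by simp
qed

text \<open>
  While a starlike tree is pruned towards its centre c, each vertex other than c is either an untouched vertex
  of a leg, with constant weight 1 (walks of length 0), or the current end of a leg, with a number of
  walks as its weight. Whenever a leg is used up, the weight of c is multiplied by a number of walks.
\<close>

lemma hom_sum_mono_starlike:
  assumes walks: "\<And>n. dominated (walks_from N n) (walks_from N' n)"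
    and "leaf_growth E c S" and "dominated (\<phi> c) (\<phi>' c)"
    and "\<And>u. u \<in> S \<Longrightarrow> u \<noteq> c \<Longrightarrow> card {w \<in> S. E u w} \<le> 2"
    and "\<And>u. u \<in> S \<Longrightarrow> u \<noteq> c \<Longrightarrow> \<exists>n. \<phi> u = walks_from N n \<and> \<phi>' u = walks_from N' n
           \<and> (n = 0 \<or> card {w \<in> S. E u w} \<le> 1)"
  shows "hom_sum E V N S \<phi> \<le> hom_sum E V N' S \<phi>'"
  using assms(2-)
proof (induction arbitrary: \<phi> \<phi>' rule: leaf_growth.induct)
  case root
  then show ?case using E_irrefl dominated_sum by (simp add: hom_sum_singleton)
next
  case (leaf S u v)
  have fin: "finite S" using leaf_growth_finite[OF leaf.hyps(1)] .
  have c: "c \<in> S" "v \<noteq> c" using leaf_growth_root_in[OF leaf.hyps(1)] leaf.hyps(3) by auto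
  obtain n where n: "\<phi> v = walks_from N n" "\<phi>' v = walks_from N' n"
    using leaf.prems(3)[of v] c by blast
  have legs: "absorb_leaf N u v \<phi> u = (\<lambda>a. \<phi> u a * walks_from N (Suc n) a)"
    "absorb_leaf N' u v \<phi>' u = (\<lambda>a. \<phi>' u a * walks_from N' (Suc n) a)"
    by (auto simp: absorb_leaf_def n)
  have deg_mono: "card {w \<in> S. E s w} \<le> card {w \<in> insert v S. E s w}" for s
    using fin by (intro card_mono) auto
  have "hom_sum E V N S (absorb_leaf N u v \<phi>) \<le> hom_sum E V N' S (absorb_leaf N' u v \<phi>')"
  proof (rule leaf.IH)
    show "dominated (absorb_leaf N u v \<phi> c) (absorb_leaf N' u v \<phi>' c)"
    proof (cases "u = c")
      case True
      show ?thesis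
        using dominated_mult[OF leaf.prems(1) walks[of "Suc n"]] unfolding True legs[unfolded True] .
    qed (use leaf.prems(1) in \<open>simp add: absorb_leaf_def\<close>)
  next
    fix s assume s: "s \<in> S" "s \<noteq> c"
    then show "card {w \<in> S. E s w} \<le> 2"
      using leaf.prems(2)[of s] deg_mono[of s] by auto
    obtain j where j: "\<phi> s = walks_from N j" "\<phi>' s = walks_from N' j"
      "j = 0 \<or> card {w \<in> insert v S. E s w} \<le> 1"
      using leaf.prems(3)[of s] s by blast
    show "\<exists>n. absorb_leaf N u v \<phi> s = walks_from N n \<and> absorb_leaf N' u v \<phi>' s = walks_from N' n
        \<and> (n = 0 \<or> card {w \<in> S. E s w} \<le> 1)"
    proof (cases "s = u")
      case False
      then show ?thesis using j deg_mono[of s]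
        by (intro exI[of _ j]) (auto simp: absorb_leaf_def)
    next
      case True
      have "{w \<in> insert v S. E s w} = insert v {w \<in> S. E s w}" using True leaf.hyps(4) by auto
      then have deg: "card {w \<in> insert v S. E s w} = Suc (card {w \<in> S. E s w})"
        using fin leaf.hyps(3) by simp
      have "{w \<in> S. E s w} \<noteq> {}"
        using leaf_growth_neighbor[OF leaf.hyps(1) E_sym s] by blast
      then have "0 < card {w \<in> S. E s w}" using fin by (simp add: card_gt_0_iff)
      \<comment> \<open>Besides the leaf v, the leg continues towards c, so s has not been touched yet.\<close>
      then have "j = 0" using j(3) deg by simp
      moreover have "card {w \<in> S. E s w} \<le> 1" using leaf.prems(2)[of s] s deg by simp
      ultimately show ?thesis using j legs True
        by (intro exI[of _ "Suc n"]) (auto simp: fun_eq_iff)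
    qed
  qed
  then show ?case using hom_sum_absorb_leaf_both[OF leaf.hyps] by simp
qed

end
end

section \<open>From graphs to the abstract setting\<close>

text \<open>
  The arcs between consecutive vertices of xs, followed by an arc to y.
\<close>

lemma closed_arc_list:
  assumes "xs \<noteq> []"
  shows "pcas (hd xs) (zip xs (tl xs @ [y])) y"
    and "pawalk_verts (hd xs) (zip xs (tl xs @ [y])) = xs @ [y]"
    and "successively (\<lambda>u v. (u, v) \<in> R) xs \<Longrightarrow> (last xs, y) \<in> R \<Longrightarrow> set (zip xs (tl xs @ [y])) \<subseteq> R"
proof -
  have "pcas (hd xs) (zip xs (tl xs @ [y])) y \<and> pawalk_verts (hd xs) (zip xs (tl xs @ [y])) = xs @ [y]
    \<and> (successively (\<lambda>u v. (u, v) \<in> R) xs \<longrightarrow> (last xs, y) \<in> R \<longrightarrow> set (zip xs (tl xs @ [y])) \<subseteq> R)"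
    using assms
  proof (induction xs)
    case (Cons x xs)
    show ?case
    proof (cases xs)
      case (Cons x' xs')
      then show ?thesis using Cons.IH by simp
    qed simp
  qed simp
  then show "pcas (hd xs) (zip xs (tl xs @ [y])) y"
    "pawalk_verts (hd xs) (zip xs (tl xs @ [y])) = xs @ [y]"
    "successively (\<lambda>u v. (u, v) \<in> R) xs \<Longrightarrow> (last xs, y) \<in> R \<Longrightarrow> set (zip xs (tl xs @ [y])) \<subseteq> R"
    by blast+
qed

lemma undirected_tree_no_cycle:
  assumes G: "undirected_tree G" and xs: "distinct xs" "3 \<le> length xs"
    "successively (\<lambda>u v. (u, v) \<in> parcs G) xs" and closing: "(last xs, hd xs) \<in> parcs G"
  shows False
proof -
  interpret pair_graph G using G by (simp add: undirected_tree_def)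
  let ?c = "zip xs (tl xs @ [hd xs])"
  have ne: "xs \<noteq> []" using xs(2) by auto
  note c = closed_arc_list[OF ne]
  have "awalk (hd xs) ?c (hd xs)"
    unfolding awalk_def using c(1,3) xs(3) closing in_arcsD2[OF closing] by simp
  moreover have "distinct (tl (pawalk_verts (hd xs) ?c))"
    using xs(1) ne by (simp add: c(2)) (metis distinct.simps(2) list.collapse)
  moreover have "?c \<noteq> []" using ne by (cases xs) auto
  ultimately have "cycle ?c" unfolding cycle_def by blast
  moreover have "3 \<le> length ?c" using xs(2) by simp
  ultimately show False using G unfolding undirected_tree_def by blast
qed

lemma undirected_tree_reachable:
  assumes G: "undirected_tree G" and "u \<in> pverts G" "v \<in> pverts G"
  shows "(u, v) \<in> (parcs G)\<^sup>*"
proof -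
  interpret pair_graph G using G by (simp add: undirected_tree_def)
  have sym: "sym (parcs G)" using pair_sym_arcs by (simp add: symmetric_def)
  have "(u, v) \<in> rtrancl_on (pverts G) ((parcs G)\<^sup>s)"
    using G assms(2,3) unfolding undirected_tree_def connected_conv by simp
  then show ?thesis
  proof (induction rule: rtrancl_on_induct)
    case (step y z)
    then have "(y, z) \<in> parcs G" using sym by (auto simp: symcl_def dest: symD)
    then show ?case using step by simp
  qed simp
qed

text \<open>
  A maximal grown vertex set is closed under adjacency: a new vertex with two neighbours in the set would
  close a cycle with the path joining these neighbours inside the set.
\<close>

lemma undirected_tree_leaf_growth:
  assumes G: "undirected_tree G" and c: "c \<in> pverts G"
  shows "leaf_growth (\<lambda>u v. (u, v) \<in> parcs G) c (pverts G)"
proof -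
  interpret pair_graph G using G by (simp add: undirected_tree_def)
  let ?E = "\<lambda>u v. (u, v) \<in> parcs G"
  have sym: "?E b a" if "?E a b" for a b
    using that pair_sym_arcs by (auto simp: symmetric_def dest: symD)
  let ?F = "{S. leaf_growth ?E c S \<and> S \<subseteq> pverts G}"
  have "finite ?F" by (rule finite_subset[of _ "Pow (pverts G)"]) (auto simp: pair_finite_verts)
  moreover have "{c} \<in> ?F" using c leaf_growth.root[of ?E c] by simp
  ultimately obtain S where S: "S \<in> ?F" "\<And>S'. S' \<in> ?F \<Longrightarrow> S \<subseteq> S' \<Longrightarrow> S = S'"
    by (metis (no_types, lifting) empty_iff finite_has_maximal)
  then have growth: "leaf_growth ?E c S" and sub: "S \<subseteq> pverts G" by auto
  have closed: "v \<in> S" if "u \<in> S" "?E u v" for u v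
  proof (rule ccontr)
    assume v: "v \<notin> S"
    \<comment> \<open>Otherwise the path from u to w inside S, closed up through v, is a cycle.\<close>
    have unique: "w = u" if w: "w \<in> S" "?E w v" for w
    proof (rule ccontr)
      assume "w \<noteq> u"
      obtain xs where xs: "distinct xs" "set xs \<subseteq> S" "xs \<noteq> []" "hd xs = u" "last xs = w" "successively ?E xs"
        using leaf_growth_path[of ?E c S u w] growth sym \<open>u \<in> S\<close> w(1) by metis
      have "2 \<le> length xs"
        using xs(3-5) \<open>w \<noteq> u\<close> by (cases xs; cases "tl xs") auto
      then show False
        using undirected_tree_no_cycle[OF G, of "xs @ [v]"] xs v w(2) sym[OF \<open>?E u v\<close>]
        by (auto simp: successively_append_iff)
    qed
    have "insert v S \<in> ?F"
      using leaf_growth.leaf[OF growth \<open>u \<in> S\<close> v \<open>?E u v\<close> unique] sub in_arcsD2[OF \<open>?E u v\<close>] by simp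
    then show False using S(2)[of "insert v S"] v by blast
  qed
  have "v \<in> S" if "(c, v) \<in> (parcs G)\<^sup>*" for v
    using that leaf_growth_root_in[OF growth] closed by (induction rule: rtrancl_induct) auto
  then have "S = pverts G" using undirected_tree_reachable[OF G c] sub by blast
  then show ?thesis using growth by simp
qed

lemma hom_count_eq_hom_sum:
  assumes "pair_graph H" "pair_graph G"
  shows "hom_count H G = hom_sum (\<lambda>u v. (u, v) \<in> parcs H) (pverts G) (neighbors G) (pverts H) (\<lambda>_ _. 1)"
proof -
  interpret H: pair_graph H by fact
  interpret G: pair_graph G by fact
  have fin: "finite (pverts H \<rightarrow>\<^sub>E pverts G)"
    by (intro finite_PiE H.pair_finite_verts G.pair_finite_verts)
  have "homs H G = {f \<in> pverts H \<rightarrow>\<^sub>E pverts G.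
      \<forall>u\<in>pverts H. \<forall>v\<in>pverts H. (u, v) \<in> parcs H \<longrightarrow> f v \<in> neighbors G (f u)}"
    unfolding homs_def neighbors_def using H.in_arcsD1 H.in_arcsD2 by fast
  then show ?thesis using fin
    by (simp add: hom_count_def hom_sum_def sum.inter_filter[symmetric])
qed

lemma pcas_arcs_nth:
  assumes "pcas x p y"
  shows "length (pawalk_verts x p) = Suc (length p)" "pawalk_verts x p ! 0 = x"
    "pawalk_verts x p ! length p = y"
    "i < length p \<Longrightarrow> p ! i = (pawalk_verts x p ! i, pawalk_verts x p ! Suc i)"
  using assms
proof (induction p arbitrary: x i)
  case (Cons e p)
  {
    case 1 then show ?case using Cons by simp
  next
    case 2 then show ?case using Cons by simp
  next
    case 3 then show ?case using Cons by simp
  next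
    case 4
    then show ?case using Cons.IH(2)[of "snd e"] Cons.IH(4)[of "i - 1" "snd e"]
      by (cases i) auto
  }
qed auto

text \<open>
  Chords of the path, and a vertex off the path adjacent to both of its ends, would give a cycle of
  length at least 3.
\<close>

lemma kc_transform_kc_move:
  assumes T: "undirected_tree T" and p: "kc_path T x p y"
  defines "q \<equiv> (!) (pawalk_verts x p)" and "k \<equiv> length p" and "T' \<equiv> kc_transform T x p y"
  shows "pair_graph T'" and "pverts T' = pverts T"
    and "kc_move (pverts T) (neighbors T) (neighbors T') q k
      (neighbors T x - {q 1}) (neighbors T y - {q (k - 1)})"
proof -
  interpret pair_graph T using T by (simp add: undirected_tree_def)
  have sym: "(b, a) \<in> parcs T" if "(a, b) \<in> parcs T" for a b
    using that pair_sym_arcs by (auto simp: symmetric_def dest: symD)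
  have no_loop: "(a, a) \<notin> parcs T" for a using pair_no_loops[of "(a, a)"] by auto
  have xy: "x \<noteq> y" and apath: "apath x p y"
    and deg: "\<And>v. v \<in> set (pawalk_verts x p) - {x, y} \<Longrightarrow> degree T v = 2"
    using p unfolding kc_path_def by auto
  then have walk: "pcas x p y" "set p \<subseteq> parcs T" "x \<in> pverts T" "distinct (pawalk_verts x p)"
    unfolding apath_def awalk_def by auto
  have len: "length (pawalk_verts x p) = Suc k" and q0: "q 0 = x" and qk: "q k = y"
    and arc: "\<And>i. i < k \<Longrightarrow> p ! i = (q i, q (Suc i))"
    using pcas_arcs_nth[OF walk(1)] by (auto simp: q_def k_def)
  have q_map: "pawalk_verts x p = map q [0..<Suc k]"
    unfolding len[symmetric] q_def by (simp only: map_nth)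
  have P: "set (pawalk_verts x p) = q ` {..k}"
    unfolding q_map by (auto simp: atLeast0LessThan lessThan_Suc_atMost simp del: upt_Suc)
  have inj: "inj_on q {..k}"
    using walk(4) unfolding q_map by (simp add: distinct_map atLeast0LessThan lessThan_Suc_atMost del: upt_Suc)
  have q_eq: "q i = q j \<longleftrightarrow> i = j" if "i \<le> k" "j \<le> k" for i j
    using inj_on_eq_iff[OF inj] that by simp
  have k_pos: "0 < k" using xy q0 qk by (cases k) auto
  have step: "(q i, q (Suc i)) \<in> parcs T" if "i < k" for i
    using arc[OF that] walk(2) that nth_mem[of i p] by (auto simp: k_def)
  have step': "(q (Suc i), q i) \<in> parcs T" if "i < k" for i
    using sym step[OF that] by blast
  have z: "fst (last p) = q (k - 1)"
    using arc[of "k - 1"] k_pos by (subst last_conv_nth) (auto simp: k_def)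
  have q_in: "q i \<in> pverts T" if "i \<le> k" for i
    using that step[of i] step'[of "k - 1"] k_pos in_arcsD1 qk by (cases "i = k") auto
  \<comment> \<open>A chord of the path would close a cycle.\<close>
  have chord: "j = Suc i" if "i < j" "j \<le> k" "(q j, q i) \<in> parcs T" for i j
  proof (rule ccontr)
    assume "j \<noteq> Suc i"
    have "distinct (map q [i..<Suc j])"
      using inj that by (auto simp: distinct_map inj_on_def simp del: upt_Suc)
    moreover have "successively (\<lambda>u v. (u, v) \<in> parcs T) (map q [i..<Suc j])"
      using step that by (auto simp: successively_conv_nth simp del: upt_Suc)
    moreover have "last (map q [i..<Suc j]) = q j" "hd (map q [i..<Suc j]) = q i"
      using that by (auto simp: last_map hd_map simp del: upt_Suc)
    moreover have "3 \<le> length (map q [i..<Suc j])"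
      using that(1) \<open>j \<noteq> Suc i\<close> by (simp del: upt_Suc)
    ultimately show False
      using undirected_tree_no_cycle[OF T, of "map q [i..<Suc j]"] that(3) by (auto simp del: upt_Suc)
  qed
  \<comment> \<open>A common neighbour of both ends off the path would close a cycle.\<close>
  have common: False if "b \<notin> q ` {..k}" "(x, b) \<in> parcs T" "(y, b) \<in> parcs T" for b
  proof -
    have "successively (\<lambda>u v. (u, v) \<in> parcs T) (map q [0..<Suc k])"
      using step by (auto simp: successively_conv_nth simp del: upt_Suc)
    moreover have "last (map q [0..<Suc k]) = y" "hd (map q [0..<Suc k]) = x"
      using q0 qk by (auto simp: last_map hd_map simp del: upt_Suc)
    moreover have "distinct (map q [0..<Suc k])" "set (map q [0..<Suc k]) = q ` {..k}"
      using walk(4) P by (simp_all only: q_map)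
    ultimately show False
      using undirected_tree_no_cycle[OF T, of "map q [0..<Suc k] @ [b]"] that k_pos sym[OF that(2)]
      by (auto simp: successively_append_iff simp del: upt_Suc)
  qed
  let ?NA = "neighbors T x - {q 1}" and ?NB = "neighbors T y - {q (k - 1)}"
  have off_A: "b \<notin> q ` {..k}" if "b \<in> ?NA" for b
  proof
    assume "b \<in> q ` {..k}"
    then obtain j where j: "j \<le> k" "b = q j" by auto
    then have "(q j, q 0) \<in> parcs T" using that sym[of x b] q0 by (auto simp: neighbors_def)
    moreover from this have "j \<noteq> 0" using no_loop[of "q 0"] by (intro notI) simp
    ultimately show False using chord[of 0 j] j that by auto
  qed
  have off_B: "b \<notin> q ` {..k}" if "b \<in> ?NB" for b
  proof
    assume "b \<in> q ` {..k}"
    then obtain j where j: "j \<le> k" "b = q j" by auto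
    then have "(q k, q j) \<in> parcs T" using that qk by (auto simp: neighbors_def)
    moreover from this have "j \<noteq> k" using no_loop[of "q k"] by (intro notI) simp
    ultimately show False using chord[of j k] j that by auto
  qed
  have inner: "neighbors T (q i) = {q (i - 1), q (i + 1)}" if "0 < i" "i < k" for i
  proof -
    have "q i \<in> set (pawalk_verts x p) - {x, y}"
      using that inj q0 qk unfolding P by (auto simp: inj_on_def)
    then have "card (neighbors T (q i)) = 2" using deg unfolding degree_def by blast
    moreover have "{q (i - 1), q (i + 1)} \<subseteq> neighbors T (q i)"
      using step[of i] step'[of "i - 1"] that by (auto simp: neighbors_def)
    moreover have "card {q (i - 1), q (i + 1)} = 2"
      using that q_eq[of "i - 1" "i + 1"] by auto
    ultimately show ?thesis by (metis card.infinite card_subset_eq zero_neq_numeral)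
  qed
  have T'_arcs: "parcs T' = (parcs T - ({y} \<times> ?NB \<union> ?NB \<times> {y})) \<union> ({x} \<times> ?NB \<union> ?NB \<times> {x})"
    and T'_verts: "pverts T' = pverts T"
    unfolding T'_def kc_transform_def z by (auto simp: Let_def)
  show "pverts T' = pverts T" by (rule T'_verts)
  have NB_in: "?NB \<subseteq> pverts T" using in_arcsD2 by (auto simp: neighbors_def)
  have xy_P: "x \<in> q ` {..k}" "y \<in> q ` {..k}" using q0 qk k_pos by auto
  have xy_NB: "x \<notin> ?NB" "y \<notin> ?NB" using off_B xy_P by blast+
  show graph: "pair_graph T'"
  proof
    fix e assume "e \<in> parcs T'"
    then show "fst e \<in> pverts T'" "snd e \<in> pverts T'" "fst e \<noteq> snd e"
      using arc_fst_in_verts[of e] arc_snd_in_verts[of e] pair_no_loops[of e] NB_in walk(3)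
        xy_NB(1)
      unfolding T'_arcs T'_verts by auto
  next
    show "finite (pverts T')" "finite (parcs T')"
      using pair_finite_verts pair_finite_arcs finite_subset[OF NB_in]
      unfolding T'_arcs T'_verts by auto
  next
    have "sym (parcs T')" unfolding T'_arcs
    proof (rule symI)
      fix a b
      assume "(a, b) \<in> parcs T - ({y} \<times> ?NB \<union> ?NB \<times> {y}) \<union> ({x} \<times> ?NB \<union> ?NB \<times> {x})"
      then show "(b, a) \<in> parcs T - ({y} \<times> ?NB \<union> ?NB \<times> {y}) \<union> ({x} \<times> ?NB \<union> ?NB \<times> {x})"
        using sym[of a b] by blast
    qed
    then show "symmetric (with_proj T')" by (simp add: symmetric_def)
  qed
  show "kc_move (pverts T) (neighbors T) (neighbors T') q k ?NA ?NB"
  proof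
    show "finite (pverts T)" by (rule pair_finite_verts)
    show "neighbors T v \<subseteq> pverts T" for v using in_arcsD2 by (auto simp: neighbors_def)
    show "v \<in> neighbors T u" if "u \<in> neighbors T v" for u v
      using that sym[of v u] by (auto simp: neighbors_def)
    show "0 < k" "inj_on q {..k}" by fact+
    show "q i \<in> pverts T" if "i \<le> k" for i using q_in that .
    show "neighbors T (q i) = {q (i - 1), q (i + 1)}" if "0 < i" "i < k" for i using inner that .
    show "neighbors T (q 0) = insert (q 1) ?NA"
      using step[of 0] k_pos q0 by (auto simp: neighbors_def)
    show "neighbors T (q k) = insert (q (k - 1)) ?NB"
      using step'[of "k - 1"] k_pos qk by (auto simp: neighbors_def)
    show "?NA \<inter> q ` {..k} = {}" "?NB \<inter> q ` {..k} = {}" using off_A off_B by blast+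
    show "?NA \<inter> ?NB = {}"
    proof (rule equals0I)
      fix b assume "b \<in> ?NA \<inter> ?NB"
      then show False using common[of b] off_A[of b] by (auto simp: neighbors_def)
    qed
    show "neighbors T' (q i) = neighbors T (q i)" if "0 < i" "i < k" for i
    proof -
      have "q i \<noteq> x" "q i \<noteq> y" "q i \<notin> ?NB"
        using that q_eq[of i 0] q_eq[of i k] q0 qk off_B[of "q i"] by auto
      then show ?thesis by (auto simp: neighbors_def T'_arcs)
    qed
    show "neighbors T' (q 0) = insert (q 1) (?NA \<union> ?NB)"
      using step[of 0] k_pos xy xy_NB unfolding q0 by (auto simp: neighbors_def T'_arcs q0)
    show "neighbors T' (q k) = {q (k - 1)}"
      using step'[of "k - 1"] k_pos xy xy_NB unfolding qk by (auto simp: neighbors_def T'_arcs qk)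
    show "neighbors T' v = (if q k \<in> neighbors T v then insert (q 0) (neighbors T v - {q k}) else neighbors T v)"
      if "v \<in> pverts T" "v \<notin> q ` {..k}" for v
    proof -
      have v: "v \<noteq> x" "v \<noteq> y" "v \<noteq> q (k - 1)" using that xy_P by auto
      have "v \<in> ?NB \<longleftrightarrow> y \<in> neighbors T v" using sym[of v y] sym[of y v] v by (auto simp: neighbors_def)
      then show ?thesis using v unfolding q0 qk by (auto simp: neighbors_def T'_arcs)
    qed
    interpret T': pair_graph T' by (rule graph)
    show "neighbors T' v \<subseteq> pverts T" for v using T'.in_arcsD2 T'_verts by (auto simp: neighbors_def)
    show "v \<in> neighbors T' u" if "u \<in> neighbors T' v" for u v
      using that T'.pair_sym_arcs by (auto simp: neighbors_def symmetric_def dest: symD)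
  qed
qed

section \<open>The inequality for homomorphism counts\<close>

theorem theorem1p3:
  fixes T T' :: "'a pair_pre_digraph" and H :: "'b pair_pre_digraph"
    and x y :: 'a and p :: "('a \<times> 'a) list" and k :: nat
  assumes "undirected_tree T"
    and "kc_path T x p y"
    and "length p = k"
    and "T' = kc_transform T x p y"
  shows "(even k \<and> undirected_tree H \<longrightarrow> hom_count H T' \<ge> hom_count H T) \<and>
         (odd k \<and> starlike_tree H \<longrightarrow> hom_count H T' \<ge> hom_count H T)"
proof -
  define q where "q = (!) (pawalk_verts x p)"
  note move = kc_transform_kc_move[OF assms(1,2), folded assms(4), unfolded assms(3), folded q_def]
  interpret T: pair_graph T using assms(1) by (simp add: undirected_tree_def)
  interpret kc_move "pverts T" "neighbors T" "neighbors T'" q k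
    "neighbors T x - {q 1}" "neighbors T y - {q (k - 1)}"
    by (rule move(3))
  let ?E = "\<lambda>u v. (u, v) \<in> parcs H"
  have growth: "leaf_growth ?E c (pverts H)" "?E a b \<Longrightarrow> ?E b a" "\<not> ?E a a"
    "hom_count H T = hom_sum ?E (pverts T) (neighbors T) (pverts H) (\<lambda>_ _. 1)"
    "hom_count H T' = hom_sum ?E (pverts T) (neighbors T') (pverts H) (\<lambda>_ _. 1)"
    if "undirected_tree H" "c \<in> pverts H" for c a b
  proof -
    interpret H: pair_graph H using that by (simp add: undirected_tree_def)
    show "leaf_growth ?E c (pverts H)" by (rule undirected_tree_leaf_growth[OF that])
    show "?E a b \<Longrightarrow> ?E b a" using H.pair_sym_arcs by (auto simp: symmetric_def dest: symD)
    show "\<not> ?E a a" using H.pair_no_loops by fastforce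
    show "hom_count H T = hom_sum ?E (pverts T) (neighbors T) (pverts H) (\<lambda>_ _. 1)"
      using hom_count_eq_hom_sum H.pair_graph T.pair_graph by blast
    show "hom_count H T' = hom_sum ?E (pverts T) (neighbors T') (pverts H) (\<lambda>_ _. 1)"
      using hom_count_eq_hom_sum[OF H.pair_graph move(1)] move(2) by simp
  qed
  have nonempty: "\<exists>c. c \<in> pverts H" if "undirected_tree H"
    using that connected_conv[of "with_proj H"] by (auto simp: undirected_tree_def)
  show ?thesis
  proof (intro conjI impI)
    assume asm: "even k \<and> undirected_tree H"
    then obtain c where c: "c \<in> pverts H" using nonempty by blast
    have H: "undirected_tree H" "even k" using asm by blast+
    have "hom_sum ?E (pverts T) (neighbors T) (pverts H) (\<lambda>_ _. 1)
        \<le> hom_sum ?E (pverts T) (neighbors T') (pverts H) (\<lambda>_ _. 1)"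
      by (rule hom_sum_mono_even[where c = c], fact growth(2)[OF H(1) c], fact growth(3)[OF H(1) c],
          rule H(2), rule growth(1)[OF H(1) c], rule dominated_const)
    then show "hom_count H T \<le> hom_count H T'" unfolding growth(4,5)[OF H(1) c] .
  next
    assume asm: "odd k \<and> starlike_tree H"
    then have H: "undirected_tree H" by (simp add: starlike_tree_def)
    interpret H: pair_graph H using H by (simp add: undirected_tree_def)
    have deg: "degree H u = card {w \<in> pverts H. ?E u w}" for u
      using H.in_arcsD2 by (auto simp: degree_def neighbors_def intro: arg_cong[where f = card])
    let ?B = "{v \<in> pverts H. degree H v > 2}"
    have "finite ?B" using H.pair_finite_verts by simp
    \<comment> \<open>If H is a path, any vertex can serve as the centre.\<close>
    obtain c where c: "c \<in> pverts H" "?B \<subseteq> {c}"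
    proof (cases "?B = {}")
      case True
      then show ?thesis using nonempty[OF H] that by blast
    next
      case False
      then have "0 < card ?B" using \<open>finite ?B\<close> by (simp only: card_gt_0_iff simp_thms)
      then have "card ?B = 1" using asm unfolding starlike_tree_def by linarith
      then obtain b where "?B = {b}" by (auto simp: card_1_singleton_iff)
      then show ?thesis using that[of b] by blast
    qed
    obtain m where m: "k = 2 * m + 1" using asm by (auto elim: oddE)
    have conn: "(v, q m) \<in> {(u, w). w \<in> neighbors T u}\<^sup>*" if "v \<in> pverts T" for v
      using undirected_tree_reachable[OF assms(1) that q_in_V[of m]] m by (simp add: neighbors_def)
    have one: "(\<lambda>_. 1) = walks_from M 0" for M :: "'a \<Rightarrow> 'a set" by auto
    have "hom_sum ?E (pverts T) (neighbors T) (pverts H) (\<lambda>_ _. 1)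
        \<le> hom_sum ?E (pverts T) (neighbors T') (pverts H) (\<lambda>_ _. 1)"
    proof (rule hom_sum_mono_starlike[where c = c])
      show "dominated (walks_from (neighbors T) n) (walks_from (neighbors T') n)" for n
        by (rule dominated_walks_odd[OF m conn])
      show "card {w \<in> pverts H. ?E u w} \<le> 2" if "u \<in> pverts H" "u \<noteq> c" for u
        using c(2) that deg by fastforce
      show "\<exists>n. (\<lambda>_. 1) = walks_from (neighbors T) n \<and> (\<lambda>_. 1) = walks_from (neighbors T') n
          \<and> (n = 0 \<or> card {w \<in> pverts H. ?E u w} \<le> 1)" for u
        using one by blast
    qed (fact growth(2)[OF H c(1)], fact growth(3)[OF H c(1)], rule growth(1)[OF H c(1)],
        rule dominated_const)
    then show "hom_count H T \<le> hom_count H T'" unfolding growth(4,5)[OF H c(1)] .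
  qed
qed

end
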